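(* Every second countable compact $T_1$ space arises as (i.e. is homeomorphic to) the spectrum $\mathsf{S}\mathbb{P}$ of some predetermined branching graded $\omega$-poset $\mathbb{P}$.
   Context: Let $(\mathbb{P},\leq)$ be a poset. A subset $S\subseteq\mathbb{P}$ refines $T\subseteq\mathbb{P}$ if for every $s\in S$ there is $t\in T$ with $s\leq t$. A band of $\mathbb{P}$ is a finite subset $B\subseteq\mathbb{P}$ such that every $p\in\mathbb{P}$ is comparable to some $b\in B$. A cap of $\mathbb{P}$ is a subset refined by some band. A selector is a subset $S\subseteq\mathbb{P}$ with $S\cap C\neq\emptyset$ for every cap $C$ of $\mathbb{P}$; a minimal selector is one minimal with respect to inclusion among all selectors. The spectrum $\mathsf{S}\mathbb{P}$ is the set of all minimal selectors, with the topology generated by the subbasis consisting of the sets $p^\in=\{S\in\mathsf{S}\mathbb{P}:p\in S\}$, for $p\in\mathbb{P}$. $\mathbb{P}$ is an $\omega$-poset if every principal filter $p^\leq=\{q\in\mathbb{P}:p\leq q\}$ is finite and, for each $n\in\omega$, the number of principal filters of size $n$ is finite. In an $\omega$-poset the rank of $p$ is the (finite) number $\mathsf{r}(p)=\sup_{q>p}(\mathsf{r}(q)+1)$, so maximal elements have rank $0$. An $\omega$-poset is graded if whenever $p<q$, the set $\{\mathsf{r}(s):p<s<q\}$ equals $\{n\in\omega:\mathsf{r}(q)<n<\mathsf{r}(p)\}$. A poset $\mathbb{P}$ is predetermined if for every non-minimal $p\in\mathbb{P}$ there is $q<p$ such that every $r>q$ satisfies $r\geq p$. A poset $\mathbb{P}$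 is branching if whenever $p<q$ there is $r<q$ with $p\nleq r$ and $r\nleq p$. *)

theory Defs
  imports "HOL-Analysis.Analysis"
begin

text \<open>
  A poset is given by a carrier \<open>P\<close> and a relation \<open>r\<close> with
  \<^term>\<open>partial_order_on P r\<close>, where \<open>(p, q) \<in> r\<close> means \<open>p \<le> q\<close>. Thus
  \<^term>\<open>above r p\<close> is the principal filter of \<open>p\<close> and
  \<^term>\<open>aboveS r p\<close>, \<^term>\<open>underS r p\<close> are the sets of elements strictly
  above and strictly below \<open>p\<close>.
\<close>

definition order_refines :: "'p rel \<Rightarrow> 'p set \<Rightarrow> 'p set \<Rightarrow> bool" where
  "order_refines r S T \<longleftrightarrow> (\<forall>s\<in>S. \<exists>t\<in>T. (s, t) \<in> r)"

definition band :: "'p set \<Rightarrow> 'p rel \<Rightarrow> 'p set \<Rightarrow> bool" where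
  "band P r B \<longleftrightarrow> finite B \<and> B \<subseteq> P \<and> (\<forall>p\<in>P. \<exists>b\<in>B. (p, b) \<in> r \<or> (b, p) \<in> r)"

definition cap :: "'p set \<Rightarrow> 'p rel \<Rightarrow> 'p set \<Rightarrow> bool" where
  "cap P r C \<longleftrightarrow> C \<subseteq> P \<and> (\<exists>B. band P r B \<and> order_refines r B C)"

definition selector :: "'p set \<Rightarrow> 'p rel \<Rightarrow> 'p set \<Rightarrow> bool" where
  "selector P r S \<longleftrightarrow> S \<subseteq> P \<and> (\<forall>C. cap P r C \<longrightarrow> S \<inter> C \<noteq> {})"

definition minimal_selector :: "'p set \<Rightarrow> 'p rel \<Rightarrow> 'p set \<Rightarrow> bool" where
  "minimal_selector P r S \<longleftrightarrow>
     selector P r S \<and> (\<forall>T. selector P r T \<and> T \<subseteq> S \<longrightarrow> T = S)"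

definition spectrum :: "'p set \<Rightarrow> 'p rel \<Rightarrow> 'p set set" where
  "spectrum P r = {S. minimal_selector P r S}"

definition spectrum_subbasic :: "'p set \<Rightarrow> 'p rel \<Rightarrow> 'p \<Rightarrow> 'p set set" where
  "spectrum_subbasic P r p = {S \<in> spectrum P r. p \<in> S}"

text \<open>
  The whole spectrum is the empty intersection of subbasic sets. It is inserted explicitly
  because the topological space of \<^const>\<open>topology_generated_by\<close> is only the union of the
  given sets.
\<close>

definition spectrum_topology :: "'p set \<Rightarrow> 'p rel \<Rightarrow> 'p set topology" where
  "spectrum_topology P r =
     topology_generated_by (insert (spectrum P r) (spectrum_subbasic P r ` P))"

definition omega_poset :: "'p set \<Rightarrow> 'p rel \<Rightarrow> bool" where
  "omega_poset P r \<longleftrightarrow>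
     partial_order_on P r \<and>
     (\<forall>p\<in>P. finite (above r p)) \<and>
     (\<forall>n. finite {F \<in> above r ` P. card F = n})"

text \<open>
  The rank is defined by well-founded recursion from the top; \<open>poset_rank_eq\<close> below is the
  recursion equation, valid in every \<open>\<omega>\<close>-poset. The suprema there are over finite sets of
  natural numbers, with \<open>Sup {} = 0\<close>. The definition is only meaningful when the strict
  order is well-founded upwards.
\<close>

definition poset_rank :: "'p rel \<Rightarrow> 'p \<Rightarrow> nat" where
  "poset_rank r = wfrec ((r - Id)\<inverse>) (\<lambda>f p. Sup ((\<lambda>q. f q + 1) ` aboveS r p))"

definition graded_poset :: "'p set \<Rightarrow> 'p rel \<Rightarrow> bool" where
  "graded_poset P r \<longleftrightarrow>
     (\<forall>p\<in>P. \<forall>q\<in>aboveS r p.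
        poset_rank r ` (aboveS r p \<inter> underS r q) = {poset_rank r q<..<poset_rank r p})"

definition predetermined_poset :: "'p set \<Rightarrow> 'p rel \<Rightarrow> bool" where
  "predetermined_poset P r \<longleftrightarrow>
     (\<forall>p\<in>P. underS r p \<noteq> {} \<longrightarrow> (\<exists>q\<in>underS r p. \<forall>s\<in>aboveS r q. (p, s) \<in> r))"

definition branching_poset :: "'p set \<Rightarrow> 'p rel \<Rightarrow> bool" where
  "branching_poset P r \<longleftrightarrow>
     (\<forall>p\<in>P. \<forall>q\<in>aboveS r p. \<exists>s\<in>underS r q. (p, s) \<notin> r \<and> (s, p) \<notin> r)"

lemma topspace_spectrum_topology [simp]: "topspace (spectrum_topology P r) = spectrum P r"
  unfolding spectrum_topology_def spectrum_subbasic_def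
  by (auto simp: topology_generated_by_topspace)

lemma omega_poset_wf:
  assumes "omega_poset P r"
  shows "wf ((r - Id)\<inverse>)"
proof (rule wf_subset)
  show "wf (inv_image less_than (\<lambda>p. card (above r p)))" by simp
  have po: "r \<subseteq> P \<times> P" "refl_on P r" "trans r" "antisym r"
    and fin: "\<And>p. p \<in> P \<Longrightarrow> finite (above r p)"
    using assms by (auto simp: omega_poset_def partial_order_on_def preorder_on_def)
  have "card (above r q) < card (above r p)" if pq: "(p, q) \<in> r" "p \<noteq> q" for p q
  proof (rule psubset_card_mono)
    show "finite (above r p)" using fin pq po(1) by blast
    have "above r q \<subseteq> above r p" using po(3) pq by (auto simp: above_def elim: transE)
    moreover have "p \<in> above r p" using po pq by (auto simp: above_def refl_on_def)
    moreover have "p \<notin> above r q" using po(4) pq by (auto simp: above_def dest: antisymD)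
    ultimately show "above r q \<subset> above r p" by blast
  qed
  then show "(r - Id)\<inverse> \<subseteq> inv_image less_than (\<lambda>p. card (above r p))" by fastforce
qed

lemma poset_rank_eq:
  assumes "omega_poset P r"
  shows "poset_rank r p = Sup ((\<lambda>q. poset_rank r q + 1) ` aboveS r p)"
proof -
  let ?R = "(r - Id)\<inverse>"
  have "poset_rank r p = Sup ((\<lambda>q. cut (poset_rank r) ?R p q + 1) ` aboveS r p)"
    using omega_poset_wf[OF assms] unfolding poset_rank_def by (subst wfrec) simp_all
  also have "(\<lambda>q. cut (poset_rank r) ?R p q + 1) ` aboveS r p
      = (\<lambda>q. poset_rank r q + 1) ` aboveS r p"
    by (rule image_cong) (auto simp: cut_apply aboveS_def)
  finally show ?thesis .
qed

end

theory Submission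
  imports Defs
begin

text \<open>
  A basis of nonempty open sets of a \<open>T\<^sub>1\<close> space, ordered by inclusion, has that space as its
  spectrum as soon as its caps are exactly its subfamilies that cover the space. Indeed, every
  selector then contains a point filter \<open>{p. x \<in> p}\<close> (otherwise each point has a basic
  neighbourhood outside the selector, and these neighbourhoods form a cap), while
  \<open>T\<^sub>1\<close> makes each point filter a minimal selector: if \<open>x \<in> p\<close>, then \<open>p\<close>
  and the basic sets that avoid \<open>x\<close> form a cover that meets the filter in \<open>p\<close> only.

  Such a basis is obtained as the union of finite open covers \<open>C\<^sub>0, C\<^sub>1, \<dots>\<close> which eventually
  refine every open cover and in which each member owns a point, that is, contains a point that
  is in no other member of the same cover. The cover \<open>C\<^sub>n\<close> becomes the set of elements of
  rank \<open>n\<close>, together with those singletons that already appeared. Gradedness asks for more than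
  refinement: an inclusion between members of distant covers must factor through each cover in
  between. For this, every member \<open>q\<close> of \<open>C\<^sub>n\<close> has to be the union of the members of
  \<open>C\<^bsub>n+1\<^esub>\<close> inside it, which is at odds with owning points if one simply discards redundant
  sets from a fine cover.

  The remedy (lemma \<open>ex_anchored_cover\<close>) is to start from points. Given a finite family \<open>G\<close>
  of open sets, choose a finite set \<open>Y\<close> of points such that every point of the space belongs to
  the same members of \<open>G\<close> as some element of \<open>Y\<close>, and attach to each \<open>y \<in> Y\<close> the
  intersection of all members of \<open>G\<close> around \<open>y\<close>, minus \<open>Y - {y}\<close>. These sets are open by
  \<open>T\<^sub>1\<close>, each owns its point \<open>y\<close>, and around any point of the space one of them lies inside
  all members of \<open>G\<close> that contain the point. Enlarging \<open>Y\<close> by two points of every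
  member of the previous cover with at least two points ensures that only singletons persist from
  one cover to the next.

  Everything else follows from separating points by fine covers: a finite family that misses a
  point \<open>x\<close> is not a band, since a sufficiently small neighbourhood of \<open>x\<close> contains no member
  of the family; branching is shown in the same way. For predetermination, a member of
  \<open>C\<^bsub>n+1\<^esub>\<close> around a point owned by \<open>p \<in> C\<^sub>n\<close> has only \<open>p\<close> above it in \<open>C\<^sub>n\<close>.
\<close>

section \<open>Anchored covers\<close>

text \<open>
  The points of \<open>Z\<close> are additional elements of \<open>Y\<close>, so that no set of the cover
  contains two of them.
\<close>

lemma ex_anchored_cover:
  fixes X :: "'a topology"
  assumes t1: "t1_space X"
    and G: "finite G" "\<forall>g\<in>G. openin X g"
    and Z: "finite Z" "Z \<subseteq> topspace X"
  obtains C where "finite C" "\<And>p. p \<in> C \<Longrightarrow> openin X p"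
    "\<And>p. p \<in> C \<Longrightarrow> \<exists>y\<in>p. (\<forall>q\<in>C. y \<in> q \<longrightarrow> q = p) \<and> (\<forall>g\<in>G. y \<in> g \<longrightarrow> p \<subseteq> g)"
    "\<And>z. z \<in> topspace X \<Longrightarrow> \<exists>p\<in>C. z \<in> p \<and> (\<forall>g\<in>G. z \<in> g \<longrightarrow> p \<subseteq> g)"
    "\<And>p x y. \<lbrakk>p \<in> C; x \<in> p \<inter> Z; y \<in> p \<inter> Z\<rbrakk> \<Longrightarrow> x = y"
proof -
  define type where "type z = {g \<in> G. z \<in> g}" for z
  have "finite (type ` topspace X)"
    by (rule finite_subset[of _ "Pow G"]) (auto simp: type_def G(1))
  then obtain Y0 where Y0: "Y0 \<subseteq> topspace X" "finite Y0" "type ` topspace X = type ` Y0"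
    by (metis finite_subset_image order_refl)
  define Y where "Y = Y0 \<union> Z"
  have Y: "Y \<subseteq> topspace X" "finite Y"
    using Y0 Z by (auto simp: Y_def)
  define e where "e y = (topspace X \<inter> \<Inter>(type y)) - (Y - {y})" for y
  have own: "y' = y" if "y \<in> Y" "y \<in> e y'" for y y'
    using that by (auto simp: e_def)
  have anchor: "y \<in> e y" if "y \<in> Y" for y
    using that Y by (auto simp: e_def type_def)
  have small: "e y \<subseteq> g" if "g \<in> G" "y \<in> g" for y g
    using that by (auto simp: e_def type_def)
  show ?thesis
  proof
    show "finite (e ` Y)" using Y by simp
  next
    fix p assume "p \<in> e ` Y"
    then obtain y where y: "y \<in> Y" "p = e y" by blast
    have "finite (type y)" using G by (simp add: type_def)
    then have "openin X (topspace X \<inter> \<Inter>(type y))"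
      using G(2) by (intro openin_Int_Inter) (auto simp: type_def)
    moreover have "closedin X (Y - {y})"
      using t1 Y by (auto simp: t1_space_closedin_finite)
    ultimately show "openin X p" unfolding y e_def by (rule openin_diff)
  next
    fix p assume "p \<in> e ` Y"
    then obtain y where y: "y \<in> Y" "p = e y" by blast
    then show "\<exists>y\<in>p. (\<forall>q\<in>e ` Y. y \<in> q \<longrightarrow> q = p) \<and> (\<forall>g\<in>G. y \<in> g \<longrightarrow> p \<subseteq> g)"
      using own anchor small by (intro bexI[of _ y]) auto
  next
    fix z assume z: "z \<in> topspace X"
    show "\<exists>p\<in>e ` Y. z \<in> p \<and> (\<forall>g\<in>G. z \<in> g \<longrightarrow> p \<subseteq> g)"
    proof (cases "z \<in> Y")
      case True
      then show ?thesis using anchor small by blast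
    next
      case False
      obtain y where y: "y \<in> Y0" "type z = type y" using z Y0 by blast
      then have "z \<in> e y" using z False by (auto simp: e_def type_def)
      moreover have "e y \<subseteq> g" if "g \<in> G" "z \<in> g" for g
        using y(2) that by (intro small) (auto simp: type_def)
      ultimately show ?thesis using y by (auto simp: Y_def)
    qed
  next
    fix p x y assume "p \<in> e ` Y" "x \<in> p \<inter> Z" "y \<in> p \<inter> Z"
    then show "x = y" using own by (auto simp: Y_def)
  qed
qed

lemma ex_universal_sequence_of_covers:
  assumes "second_countable X" and "compact_space X"
  obtains D :: "nat \<Rightarrow> 'a set set"
  where "\<And>n. finite (D n)" "\<And>n d. d \<in> D n \<Longrightarrow> openin X d" "\<And>n. topspace X \<subseteq> \<Union>(D n)"
    "\<And>\<U>. \<lbrakk>\<And>U. U \<in> \<U> \<Longrightarrow> openin X U; topspace X \<subseteq> \<Union>\<U>\<rbrakk>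
      \<Longrightarrow> \<exists>n. \<forall>d\<in>D n. \<exists>U\<in>\<U>. d \<subseteq> U"
proof -
  obtain \<B> where "countable \<B> \<and> (\<forall>V\<in>\<B>. openin X V) \<and>
      (\<forall>U x. openin X U \<and> x \<in> U \<longrightarrow> (\<exists>V\<in>\<B>. x \<in> V \<and> V \<subseteq> U))"
    using assms(1) unfolding second_countable_def ..
  then have \<B>: "countable \<B>" "\<And>V. V \<in> \<B> \<Longrightarrow> openin X V"
    and base: "\<And>U x. \<lbrakk>openin X U; x \<in> U\<rbrakk> \<Longrightarrow> \<exists>V\<in>\<B>. x \<in> V \<and> V \<subseteq> U"
    by auto
  define \<F> where "\<F> = {F. finite F \<and> F \<subseteq> \<B> \<and> topspace X \<subseteq> \<Union>F}"
  have "countable \<F>"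
    using countable_Collect_finite_subset[OF \<B>(1)]
    by (rule countable_subset[rotated]) (auto simp: \<F>_def)
  have refine: "\<exists>F\<in>\<F>. \<forall>d\<in>F. \<exists>U\<in>\<U>. d \<subseteq> U"
    if \<U>: "\<And>U. U \<in> \<U> \<Longrightarrow> openin X U" "topspace X \<subseteq> \<Union>\<U>" for \<U>
  proof -
    let ?\<V> = "{V \<in> \<B>. \<exists>U\<in>\<U>. V \<subseteq> U}"
    have "topspace X \<subseteq> \<Union>?\<V>"
    proof
      fix x assume "x \<in> topspace X"
      then obtain U where "U \<in> \<U>" "x \<in> U" using \<U> by blast
      then show "x \<in> \<Union>?\<V>" using base[of U x] \<U> by blast
    qed
    then obtain F where "finite F" "F \<subseteq> ?\<V>" "topspace X \<subseteq> \<Union>F"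
      using assms(2) \<B>(2) unfolding compact_space_alt by (metis (no_types, lifting) mem_Collect_eq)
    then show ?thesis unfolding \<F>_def by blast
  qed
  have "\<exists>F\<in>\<F>. \<forall>d\<in>F. \<exists>U\<in>{topspace X}. d \<subseteq> U" by (rule refine) auto
  then have "\<F> \<noteq> {}" by blast
  note D = from_nat_into[OF this]
  show ?thesis
  proof (rule that[of "from_nat_into \<F>"])
    fix \<U> assume "\<And>U. U \<in> \<U> \<Longrightarrow> openin X U" "topspace X \<subseteq> \<Union>\<U>"
    then obtain F where F: "F \<in> \<F>" "\<forall>d\<in>F. \<exists>U\<in>\<U>. d \<subseteq> U" using refine[of \<U>] by blast
    obtain n where "from_nat_into \<F> n = F"
      using from_nat_into_surj[OF \<open>countable \<F>\<close> F(1)] by blast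
    then show "\<exists>n. \<forall>d\<in>from_nat_into \<F> n. \<exists>U\<in>\<U>. d \<subseteq> U" using F(2) by auto
  next
    show "finite (from_nat_into \<F> n)" for n using D[of n] by (simp add: \<F>_def)
    show "openin X d" if "d \<in> from_nat_into \<F> n" for d n
      using D[of n] that \<B>(2) by (auto simp: \<F>_def)
    show "topspace X \<subseteq> \<Union>(from_nat_into \<F> n)" for n using D[of n] by (simp add: \<F>_def)
  qed
qed

section \<open>The poset of a refining sequence of covers\<close>

text \<open>
  The covers are indexed, \<open>u i\<close> being the open set named by \<open>i\<close>, so that the elements of the
  poset can be taken from any sufficiently large type. The assumption \<open>anchored\<close> provides
  refinement and, with \<open>union_of_next\<close>, interpolation of inclusions; \<open>persistent_singleton\<close>
  confines each set with at least two points to a single cover, whose number is its rank.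
\<close>

locale refining_covers =
  fixes X :: "'a topology" and L :: "nat \<Rightarrow> 'p set" and u :: "'p \<Rightarrow> 'a set"
  assumes t1: "t1_space X"
    and inj: "inj_on u (\<Union>n. L n)"
    and finite_level: "finite (L n)"
    and open_set: "i \<in> L n \<Longrightarrow> openin X (u i)"
    and covers: "x \<in> topspace X \<Longrightarrow> \<exists>i\<in>L n. x \<in> u i"
    and owns_point: "i \<in> L n \<Longrightarrow> \<exists>x\<in>u i. \<forall>j\<in>L n. x \<in> u j \<longrightarrow> j = i"
    and anchored: "i \<in> L (Suc n) \<Longrightarrow> \<exists>y\<in>u i. \<forall>j\<in>L n. y \<in> u j \<longrightarrow> u i \<subseteq> u j"
    and union_of_next: "\<lbrakk>j \<in> L n; x \<in> u j\<rbrakk> \<Longrightarrow> \<exists>i\<in>L (Suc n). x \<in> u i \<and> u i \<subseteq> u j"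
    and persistent_singleton: "\<lbrakk>i \<in> L n; i \<in> L (Suc n)\<rbrakk> \<Longrightarrow> \<exists>x. u i = {x}"
    and eventually_fine: "\<lbrakk>\<And>U. U \<in> \<U> \<Longrightarrow> openin X U; topspace X \<subseteq> \<Union>\<U>\<rbrakk>
      \<Longrightarrow> \<exists>n. \<forall>i\<in>L n. \<exists>U\<in>\<U>. u i \<subseteq> U"
begin

definition P :: "'p set" where "P = (\<Union>n. L n)"

definition le :: "'p rel" where "le = {(i, j). i \<in> P \<and> j \<in> P \<and> u i \<subseteq> u j}"

definition level :: "'p \<Rightarrow> nat" where "level i = (LEAST n. i \<in> L n)"

lemma level_subset_P: "L n \<subseteq> P"
  by (auto simp: P_def)

lemma in_level: "i \<in> P \<Longrightarrow> i \<in> L (level i)"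
  unfolding level_def P_def by (auto intro: LeastI)

lemma level_le: "i \<in> L n \<Longrightarrow> level i \<le> n"
  unfolding level_def by (rule Least_le)

lemma u_eq_iff: "\<lbrakk>i \<in> P; j \<in> P\<rbrakk> \<Longrightarrow> u i = u j \<longleftrightarrow> i = j"
  using inj by (auto simp: P_def inj_on_def)

lemma u_subset_topspace: "i \<in> P \<Longrightarrow> u i \<subseteq> topspace X"
  using open_set in_level by (metis openin_subset)

lemma u_nonempty: "i \<in> P \<Longrightarrow> u i \<noteq> {}"
  using owns_point in_level by blast

lemma level_antichain: "\<lbrakk>i \<in> L n; j \<in> L n; u i \<subseteq> u j\<rbrakk> \<Longrightarrow> i = j"
  using owns_point[of i n] by blast

lemma coarser_above:
  assumes "m \<le> n" "i \<in> L n"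
  shows "\<exists>j\<in>L m. u i \<subseteq> u j"
  using assms
proof (induction n arbitrary: i rule: dec_induct)
  case (step n)
  obtain y where y: "y \<in> u i" "\<forall>j\<in>L n. y \<in> u j \<longrightarrow> u i \<subseteq> u j"
    using anchored step.prems by blast
  moreover have "y \<in> topspace X"
    using y step.prems u_subset_topspace level_subset_P by blast
  ultimately obtain j where "j \<in> L n" "u i \<subseteq> u j"
    using covers by blast
  then show ?case using step.IH by blast
qed blast

lemma union_of_finer:
  assumes "m \<le> n" "j \<in> L m" "x \<in> u j"
  shows "\<exists>i\<in>L n. x \<in> u i \<and> u i \<subseteq> u j"
  using assms
proof (induction n rule: dec_induct)
  case (step n)
  then show ?case using union_of_next by (meson subset_trans)
qed blast

text \<open>
  The interpolating set is found by following the anchor \<open>y\<close> of the smaller set: a member of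
  the previous cover that contains \<open>y\<close> automatically contains the whole set.
\<close>

lemma interpolate:
  assumes "k \<le> m" "m \<le> n" "p \<in> L n" "q \<in> L k" "u p \<subseteq> u q"
  shows "\<exists>s\<in>L m. u p \<subseteq> u s \<and> u s \<subseteq> u q"
  using assms(2,3,5)
proof (induction n arbitrary: p rule: dec_induct)
  case (step n)
  obtain y where y: "y \<in> u p" "\<forall>j\<in>L n. y \<in> u j \<longrightarrow> u p \<subseteq> u j"
    using anchored step.prems by blast
  moreover have "k \<le> n" "y \<in> u q" using assms(1) step y by auto
  ultimately obtain s where "s \<in> L n" "u p \<subseteq> u s" "u s \<subseteq> u q"
    using union_of_finer[of k n q y] assms(4) by blast
  then show ?case using step.IH by (meson subset_trans)
qed blast

text \<open>
  A set that reappears in a later cover is already in the next one, because it lies inside some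
  member of that cover and the members of its own cover form an antichain.
\<close>

lemma singleton_if_two_levels:
  assumes "i \<in> L m" "i \<in> L n" "m < n"
  shows "\<exists>x. u i = {x}"
proof -
  obtain t where t: "t \<in> L (Suc m)" "u i \<subseteq> u t"
    using coarser_above[of "Suc m" n i] assms by auto
  moreover obtain t' where t': "t' \<in> L m" "u t \<subseteq> u t'"
    using coarser_above[of m "Suc m" t] t by auto
  ultimately have "i = t'" using level_antichain assms by blast
  then have "i = t" using t t' u_eq_iff level_subset_P by blast
  then show ?thesis using persistent_singleton assms t by blast
qed

lemma level_unique:
  assumes "q \<in> L n" "p \<in> P" "u p \<subset> u q"
  shows "level q = n"
proof (rule ccontr)
  assume "level q \<noteq> n"
  then have "level q < n" using level_le assms(1) by (simp add: order_less_le)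
  then obtain x where "u q = {x}"
    using singleton_if_two_levels in_level assms(1) level_subset_P by blast
  then show False using assms u_nonempty by (metis psubset_eq subset_singletonD)
qed

lemma level_strict_mono:
  assumes "p \<in> P" "q \<in> P" "u p \<subset> u q"
  shows "level q < level p"
proof (rule ccontr)
  assume "\<not> level q < level p"
  then obtain t where "t \<in> L (level p)" "u q \<subseteq> u t"
    using coarser_above[of "level p" "level q" q] in_level assms by auto
  then show False using level_antichain[of p "level p" t] in_level assms by blast
qed

lemma aboveS_le: "aboveS le p = {q \<in> P. p \<in> P \<and> u p \<subset> u q}"
  using u_eq_iff by (auto simp: aboveS_def le_def)

lemma underS_le: "underS le q = {p \<in> P. q \<in> P \<and> u p \<subset> u q}"
  using u_eq_iff by (auto simp: underS_def le_def)

lemma ex_between_at_level: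
  assumes "p \<in> P" "q \<in> P" "u p \<subset> u q" "level q < m" "m < level p"
  shows "\<exists>s\<in>P. u p \<subset> u s \<and> u s \<subset> u q \<and> level s = m"
proof -
  obtain s where s: "s \<in> L m" "u p \<subseteq> u s" "u s \<subseteq> u q"
    using interpolate[of "level q" m "level p" p q] assms in_level by auto
  have sP: "s \<in> P" using s level_subset_P by blast
  have "s \<noteq> p" using s(1) assms(5) level_le[of s m] by auto
  then have ps: "u p \<subset> u s" using s(2) u_eq_iff sP assms(1) by blast
  then have "level s = m" using level_unique s(1) assms(1) by blast
  moreover have "u s \<noteq> u q" using u_eq_iff sP assms \<open>level s = m\<close> by auto
  ultimately show ?thesis using ps s sP by blast
qed

lemma ex_above_at_level:
  assumes "p \<in> P" "m < level p"
  shows "\<exists>s\<in>P. u p \<subset> u s \<and> level s = m"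
proof -
  obtain s where s: "s \<in> L m" "u p \<subseteq> u s"
    using coarser_above[of m "level p" p] assms in_level by auto
  have "s \<noteq> p" using s assms(2) level_le[of s m] by auto
  then show ?thesis
    using s level_unique[of s m p] assms(1) u_eq_iff level_subset_P by blast
qed

section \<open>Order properties\<close>

lemma above_le_subset: "p \<in> P \<Longrightarrow> above le p \<subseteq> insert p (\<Union>n<level p. L n)"
proof
  fix q assume p: "p \<in> P" and "q \<in> above le p"
  then have q: "q \<in> P" "u p \<subseteq> u q" by (auto simp: above_def le_def)
  show "q \<in> insert p (\<Union>n<level p. L n)"
  proof (cases "q = p")
    case False
    then have "level q < level p" using level_strict_mono p q u_eq_iff by blast
    then show ?thesis using in_level[OF q(1)] by blast
  qed simp
qed

text \<open>
  A set of level \<open>m\<close> has a set of each level up to \<open>m\<close> above it, so principal filters of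
  size \<open>n\<close> come from the first \<open>n\<close> covers.
\<close>

lemma omega_poset_le: "omega_poset P le"
  unfolding omega_poset_def
proof (intro conjI ballI allI)
  show "partial_order_on P le"
    unfolding partial_order_on_def preorder_on_def
    using u_eq_iff by (auto simp: le_def refl_on_def trans_def antisym_def)
  show fin: "finite (above le p)" if "p \<in> P" for p
    using above_le_subset[OF that] finite_level by (auto intro: finite_subset)
  fix n
  have "{F \<in> above le ` P. card F = n} \<subseteq> above le ` (\<Union>m<n. L m)"
  proof clarify
    fix p assume p: "p \<in> P" "n = card (above le p)"
    have "{..level p} \<subseteq> level ` above le p"
    proof
      fix m assume "m \<in> {..level p}"
      then consider "m = level p" | "m < level p" by fastforce
      then show "m \<in> level ` above le p"
      proof cases
        case 1
        then show ?thesis using p by (auto simp: above_def le_def)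
      next
        case 2
        then obtain s where "s \<in> P" "u p \<subset> u s" "level s = m"
          using ex_above_at_level p(1) by blast
        then show ?thesis using p(1) by (auto simp: above_def le_def)
      qed
    qed
    then have "card {..level p} \<le> card (level ` above le p)"
      using fin p(1) by (intro card_mono) auto
    also have "\<dots> \<le> n" using p fin by (simp add: card_image_le)
    finally have "level p < n" by simp
    then show "above le p \<in> above le ` (\<Union>m<card (above le p). L m)"
      using in_level p by blast
  qed
  moreover have "finite (above le ` (\<Union>m<n. L m))" using finite_level by simp
  ultimately show "finite {F \<in> above le ` P. card F = n}" by (rule finite_subset)
qed

lemma poset_rank_le: "p \<in> P \<Longrightarrow> poset_rank le p = level p"
proof (induction "level p" arbitrary: p rule: less_induct)
  case less
  have rank: "poset_rank le q = level q" if "q \<in> aboveS le p" for q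
    using that less level_strict_mono by (auto simp: aboveS_le)
  have "(\<lambda>q. poset_rank le q + 1) ` aboveS le p = (\<lambda>n. n + 1) ` level ` aboveS le p"
    using rank by (simp add: image_image)
  also have "level ` aboveS le p = {..<level p}"
    using level_strict_mono ex_above_at_level less.prems
    by (fastforce simp: aboveS_le image_iff)
  also have "(\<lambda>n. n + 1) ` {..<level p} = {1..level p}"
    by (simp add: image_Suc_lessThan)
  finally have "poset_rank le p = Sup {1..level p}"
    by (subst poset_rank_eq[OF omega_poset_le]) (rule arg_cong)
  then show ?case by (cases "level p = 0") auto
qed

lemma graded_poset_le: "graded_poset P le"
  unfolding graded_poset_def
proof (intro ballI equalityI subsetI)
  fix p q m assume p: "p \<in> P" and q: "q \<in> aboveS le p"
    and "m \<in> poset_rank le ` (aboveS le p \<inter> underS le q)"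
  then show "m \<in> {poset_rank le q<..<poset_rank le p}"
    using level_strict_mono by (auto simp: aboveS_le underS_le poset_rank_le)
next
  fix p q m assume p: "p \<in> P" and q: "q \<in> aboveS le p"
    and "m \<in> {poset_rank le q<..<poset_rank le p}"
  then have "level q < m" "m < level p" "u p \<subset> u q" "q \<in> P"
    by (auto simp: aboveS_le poset_rank_le)
  then obtain s where "s \<in> P" "u p \<subset> u s" "u s \<subset> u q" "level s = m"
    using ex_between_at_level p by blast
  then show "m \<in> poset_rank le ` (aboveS le p \<inter> underS le q)"
    using p q by (intro image_eqI[of _ _ s]) (auto simp: aboveS_le underS_le poset_rank_le)
qed

text \<open>
  The predetermining element below \<open>p\<close> is a set of the next cover around a point owned by \<open>p\<close>.
\<close>

lemma predetermined_poset_le: "predetermined_poset P le"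
  unfolding predetermined_poset_def
proof (intro ballI impI)
  fix p assume p: "p \<in> P" "underS le p \<noteq> {}"
  define n where "n = level p"
  have pn: "p \<in> L n" using in_level p n_def by simp
  obtain x where x: "x \<in> u p" "\<And>j. \<lbrakk>j \<in> L n; x \<in> u j\<rbrakk> \<Longrightarrow> j = p"
    using owns_point[OF pn] by blast
  obtain q where q: "q \<in> L (Suc n)" "x \<in> u q" "u q \<subseteq> u p"
    using union_of_next[OF pn x(1)] by blast
  have qP: "q \<in> P" using q level_subset_P by blast
  \<comment> \<open>Having something below it, \<open>p\<close> is no singleton and hence is in the cover \<open>n\<close> only.\<close>
  have "q \<noteq> p"
    using q(1) p level_unique[of p "Suc n"] by (auto simp: underS_le n_def)
  then have "q \<in> underS le p"
    using q qP p u_eq_iff by (auto simp: underS_le)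
  moreover have "(p, s) \<in> le" if "s \<in> aboveS le q" for s
  proof -
    have s: "s \<in> P" "u q \<subset> u s" using that by (auto simp: aboveS_le)
    have "level s \<le> n"
      using level_strict_mono[OF qP s] level_le[OF q(1)] by simp
    then obtain t where "t \<in> L n" "u q \<subseteq> u t" "u t \<subseteq> u s"
      using interpolate[of "level s" n "Suc n" q s] in_level s q(1) by auto
    then show ?thesis using x(2)[of t] q s p by (auto simp: le_def)
  qed
  ultimately show "\<exists>q\<in>underS le p. \<forall>s\<in>aboveS le q. (p, s) \<in> le" by blast
qed

section \<open>Caps are covers\<close>

text \<open>
  The members around \<open>x\<close> of any cover that refines \<open>{U - Y, topspace X - {x}}\<close> lie in
  \<open>U - Y\<close>, as they cannot lie in the other set.
\<close>

lemma ex_neighbourhood_avoiding: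
  assumes "openin X U" "x \<in> U" "finite Y" "Y \<subseteq> topspace X" "x \<notin> Y"
  shows "\<exists>i\<in>P. x \<in> u i \<and> u i \<subseteq> U \<and> u i \<inter> Y = {}"
proof -
  have xX: "x \<in> topspace X" using assms openin_subset by blast
  have "closedin X Y" "closedin X {x}"
    using t1 assms xX by (auto simp: t1_space_closedin_finite)
  then have "openin X (U - Y)" "openin X (topspace X - {x})"
    using assms by (auto intro: openin_diff)
  then obtain n where n: "\<forall>i\<in>L n. \<exists>V\<in>{U - Y, topspace X - {x}}. u i \<subseteq> V"
    using eventually_fine[of "{U - Y, topspace X - {x}}"] assms by auto
  obtain i where "i \<in> L n" "x \<in> u i" using covers xX by blast
  then show ?thesis using n level_subset_P by blast
qed

lemma branching_poset_le: "branching_poset P le"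
  unfolding branching_poset_def
proof (intro ballI)
  fix p q assume p: "p \<in> P" and "q \<in> aboveS le p"
  then have q: "q \<in> P" "u p \<subset> u q" by (auto simp: aboveS_le)
  obtain x y where xy: "x \<in> u q" "x \<notin> u p" "y \<in> u p" using q u_nonempty p by blast
  obtain s where "s \<in> P" "x \<in> u s" "u s \<subseteq> u q" "y \<notin> u s"
    using ex_neighbourhood_avoiding[of "u q" x "{y}"] xy q p in_level open_set
      u_subset_topspace[OF p] by blast
  then show "\<exists>s\<in>underS le q. (p, s) \<notin> le \<and> (s, p) \<notin> le"
    using xy q by (intro bexI[of _ s]) (unfold underS_le, auto simp: le_def)
qed

lemma band_level: "band P le (L n)"
  unfolding band_def
proof (intro conjI ballI)
  fix p assume p: "p \<in> P"
  show "\<exists>b\<in>L n. (p, b) \<in> le \<or> (b, p) \<in> le"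
  proof (cases "n \<le> level p")
    case True
    then obtain b where "b \<in> L n" "u p \<subseteq> u b" using coarser_above in_level p by blast
    then show ?thesis using p level_subset_P by (auto simp: le_def)
  next
    case False
    moreover obtain x where "x \<in> u p" using u_nonempty p by blast
    ultimately obtain b where "b \<in> L n" "u b \<subseteq> u p"
      using union_of_finer[of "level p" n p x] in_level p by auto
    then show ?thesis using p level_subset_P by (auto simp: le_def)
  qed
qed (use finite_level level_subset_P in auto)

text \<open>
  If \<open>B\<close> misses \<open>x\<close>, then a neighbourhood of \<open>x\<close> that avoids one chosen point of each
  member of \<open>B\<close> is incomparable to all of them.
\<close>

lemma band_covers:
  assumes "band P le B"
  shows "topspace X \<subseteq> \<Union>(u ` B)"
proof (rule ccontr)
  assume "\<not> ?thesis"
  then obtain x where x: "x \<in> topspace X" "\<And>b. b \<in> B \<Longrightarrow> x \<notin> u b" by blast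
  have B: "finite B" "B \<subseteq> P" using assms by (auto simp: band_def)
  have "\<forall>b\<in>B. \<exists>z. z \<in> u b" using u_nonempty B(2) by blast
  then obtain y where y: "\<And>b. b \<in> B \<Longrightarrow> y b \<in> u b" by metis
  obtain p where p: "p \<in> P" "x \<in> u p" "u p \<inter> y ` B = {}"
    using ex_neighbourhood_avoiding[of "topspace X" x "y ` B"] x B y u_subset_topspace by blast
  obtain b where "b \<in> B" "(p, b) \<in> le \<or> (b, p) \<in> le"
    using assms p(1) by (auto simp: band_def)
  then show False using p x y by (auto simp: le_def)
qed

lemma cap_iff_cover: "cap P le S \<longleftrightarrow> S \<subseteq> P \<and> topspace X \<subseteq> \<Union>(u ` S)"
proof
  assume "cap P le S"
  then obtain B where "S \<subseteq> P" "band P le B" "order_refines le B S" by (auto simp: cap_def)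
  then show "S \<subseteq> P \<and> topspace X \<subseteq> \<Union>(u ` S)"
    using band_covers[of B] by (fastforce simp: order_refines_def le_def)
next
  assume S: "S \<subseteq> P \<and> topspace X \<subseteq> \<Union>(u ` S)"
  obtain n where "\<forall>i\<in>L n. \<exists>U\<in>u ` S. u i \<subseteq> U"
    using eventually_fine[of "u ` S"] S in_level open_set by blast
  then have "order_refines le (L n) S"
    using S level_subset_P by (fastforce simp: order_refines_def le_def)
  then show "cap P le S" using S band_level by (auto simp: cap_def)
qed

section \<open>The spectrum\<close>

definition point_filter :: "'a \<Rightarrow> 'p set" where
  "point_filter x = {i \<in> P. x \<in> u i}"

lemma selector_point_filter: "x \<in> topspace X \<Longrightarrow> selector P le (point_filter x)"
  by (fastforce simp: selector_def point_filter_def cap_iff_cover)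

lemma selector_contains_point_filter:
  assumes "selector P le S"
  shows "\<exists>x\<in>topspace X. point_filter x \<subseteq> S"
proof (rule ccontr)
  assume "\<not> ?thesis"
  then have "topspace X \<subseteq> \<Union>(u ` (P - S))" by (fastforce simp: point_filter_def)
  then have "cap P le (P - S)" by (auto simp: cap_iff_cover)
  then show False using assms by (auto simp: selector_def)
qed

lemma minimal_selector_point_filter:
  assumes x: "x \<in> topspace X"
  shows "minimal_selector P le (point_filter x)"
  unfolding minimal_selector_def
proof (intro conjI allI impI)
  show "selector P le (point_filter x)" using selector_point_filter x .
  fix T assume T: "selector P le T \<and> T \<subseteq> point_filter x"
  have "point_filter x \<subseteq> T"
  proof
    fix p assume p: "p \<in> point_filter x"
    \<comment> \<open>A cap that meets the point filter of \<open>x\<close> in \<open>p\<close> alone.\<close>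
    let ?C = "insert p {q \<in> P. x \<notin> u q}"
    have "topspace X \<subseteq> \<Union>(u ` ?C)"
    proof
      fix z assume z: "z \<in> topspace X"
      show "z \<in> \<Union>(u ` ?C)"
      proof (cases "z = x")
        case True
        then show ?thesis using p by (auto simp: point_filter_def)
      next
        case False
        then show ?thesis
          using ex_neighbourhood_avoiding[of "topspace X" z "{x}"] x z by auto
      qed
    qed
    then have "cap P le ?C" using p by (auto simp: cap_iff_cover point_filter_def)
    then have "T \<inter> ?C \<noteq> {}" using T by (auto simp: selector_def)
    then show "p \<in> T" using T by (auto simp: point_filter_def)
  qed
  then show "T = point_filter x" using T by blast
qed

lemma spectrum_eq: "spectrum P le = point_filter ` topspace X"
proof (intro equalityI subsetI)
  fix S assume "S \<in> spectrum P le"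
  then have S: "minimal_selector P le S" by (simp add: spectrum_def)
  then obtain x where "x \<in> topspace X" "point_filter x \<subseteq> S"
    using selector_contains_point_filter[of S] by (auto simp: minimal_selector_def)
  then show "S \<in> point_filter ` topspace X"
    using S selector_point_filter by (auto simp: minimal_selector_def)
qed (auto simp: spectrum_def minimal_selector_point_filter)

lemma inj_point_filter: "inj_on point_filter (topspace X)"
proof (rule inj_onI, rule ccontr)
  fix x y assume xy: "x \<in> topspace X" "y \<in> topspace X"
    "point_filter x = point_filter y" "x \<noteq> y"
  then obtain i where "i \<in> P" "x \<in> u i" "y \<notin> u i"
    using ex_neighbourhood_avoiding[of "topspace X" x "{y}"] by auto
  then show False using xy by (auto simp: point_filter_def)
qed

lemma spectrum_subbasic_eq: "i \<in> P \<Longrightarrow> spectrum_subbasic P le i = point_filter ` u i"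
  using u_subset_topspace[of i]
  by (auto simp: spectrum_subbasic_def spectrum_eq point_filter_def)

lemma homeomorphic_space_spectrum: "X homeomorphic_space spectrum_topology P le"
proof -
  let ?S = "insert (spectrum P le) (spectrum_subbasic P le ` P)"
  have "homeomorphic_map X (spectrum_topology P le) point_filter"
  proof (rule bijective_open_imp_homeomorphic_map)
    have "point_filter -` U \<inter> topspace X = topspace X
        \<or> (\<exists>i\<in>P. point_filter -` U \<inter> topspace X = u i)" if U: "U \<in> ?S" for U
    proof (cases "U = spectrum P le")
      case False
      then obtain i where i: "i \<in> P" "U = spectrum_subbasic P le i" using U by blast
      then have "point_filter -` U \<inter> topspace X = u i"
        using u_subset_topspace[of i] by (auto simp: spectrum_subbasic_def spectrum_eq point_filter_def)
      then show ?thesis using i by blast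
    qed (auto simp: spectrum_eq)
    then have "openin X (point_filter -` U \<inter> topspace X)" if "U \<in> ?S" for U
      using that open_set in_level openin_topspace by metis
    then show "continuous_map X (spectrum_topology P le) point_filter"
      unfolding spectrum_topology_def
      by (intro continuous_on_generated_topo) (auto simp: spectrum_eq)
    show "open_map X (spectrum_topology P le) point_filter"
      unfolding open_map_def
    proof (intro allI impI)
      fix U assume U: "openin X U"
      have "U = \<Union>(u ` {i \<in> P. u i \<subseteq> U})"
        using ex_neighbourhood_avoiding[OF U, of _ "{}"] by fastforce
      then have "point_filter ` U = (\<Union>i\<in>{i \<in> P. u i \<subseteq> U}. point_filter ` u i)"
        by (metis image_UN)
      then have "point_filter ` U = \<Union>(spectrum_subbasic P le ` {i \<in> P. u i \<subseteq> U})"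
        by (simp add: spectrum_subbasic_eq)
      moreover have "openin (spectrum_topology P le) (spectrum_subbasic P le i)" if "i \<in> P" for i
        unfolding spectrum_topology_def using that by (intro topology_generated_by_Basis) auto
      ultimately show "openin (spectrum_topology P le) (point_filter ` U)" by auto
    qed
  qed (auto simp: spectrum_eq inj_point_filter)
  then show ?thesis by (rule homeomorphic_map_imp_homeomorphic_space)
qed

end

section \<open>Existence\<close>

text \<open>
  Each cover is anchored at the union of its predecessor and the next member of a universal sequence
  of covers, with \<open>Z\<close> containing two points of every member of its predecessor that has two.
\<close>

lemma ex_refining_sequence:
  fixes X :: "'a topology"
  assumes sc: "second_countable X" and comp: "compact_space X" and t1: "t1_space X"
  shows "\<exists>C. refining_covers X C (\<lambda>p :: 'a set. p)"
proof -
  obtain D :: "nat \<Rightarrow> 'a set set" where D: "\<And>n. finite (D n)"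
    "\<And>n d. d \<in> D n \<Longrightarrow> openin X d" "\<And>n. topspace X \<subseteq> \<Union>(D n)"
    and universal: "\<And>\<U>. \<lbrakk>\<And>U. U \<in> \<U> \<Longrightarrow> openin X U; topspace X \<subseteq> \<Union>\<U>\<rbrakk>
      \<Longrightarrow> \<exists>n. \<forall>d\<in>D n. \<exists>U\<in>\<U>. d \<subseteq> U"
    by (fact ex_universal_sequence_of_covers[OF sc comp])
  define good where "good C \<longleftrightarrow> finite C \<and> (\<forall>p\<in>C. openin X p) \<and> topspace X \<subseteq> \<Union>C \<and>
    (\<forall>p\<in>C. \<exists>x\<in>p. \<forall>q\<in>C. x \<in> q \<longrightarrow> q = p)" for C
  define next_cover where "next_cover n C C' \<longleftrightarrow>
    (\<forall>p\<in>C'. \<exists>y\<in>p. \<forall>g\<in>C. y \<in> g \<longrightarrow> p \<subseteq> g) \<and>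
    (\<forall>q\<in>C. \<forall>z\<in>q. \<exists>p\<in>C'. z \<in> p \<and> p \<subseteq> q) \<and>
    (\<forall>p\<in>C \<inter> C'. \<exists>x. p = {x}) \<and>
    (\<forall>p\<in>C'. \<exists>d\<in>D n. p \<subseteq> d)" for n C C'
  \<comment> \<open>Removing the empty set matters for the empty space, whose starting cover is empty.\<close>
  have start: "good ({topspace X} - {{}})"
    by (auto simp: good_def)
  have step: "\<exists>C'. good C' \<and> next_cover n C C'" if "good C" for n C
  proof -
    have C: "finite C" "\<And>p. p \<in> C \<Longrightarrow> openin X p" "\<And>p. p \<in> C \<Longrightarrow> \<exists>x. x \<in> p"
      using that unfolding good_def by blast+
    have "\<exists>x y. x \<in> p \<and> y \<in> p \<and> (x = y \<longrightarrow> p = {x})" if p: "p \<in> C" for p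
    proof -
      obtain x where x: "x \<in> p" using C(3) p by blast
      show ?thesis
      proof (cases "p = {x}")
        case False
        then obtain y where "y \<in> p" "y \<noteq> x" using x by blast
        then show ?thesis using x by metis
      qed blast
    qed
    then have "\<forall>p\<in>C. \<exists>x y. x \<in> p \<and> y \<in> p \<and> (x = y \<longrightarrow> p = {x})" by blast
    from bchoice[OF this] obtain a
      where "\<forall>p\<in>C. \<exists>y. a p \<in> p \<and> y \<in> p \<and> (a p = y \<longrightarrow> p = {a p})" ..
    from bchoice[OF this] obtain b
      where ab: "\<forall>p\<in>C. a p \<in> p \<and> b p \<in> p \<and> (a p = b p \<longrightarrow> p = {a p})" ..
    define Z where "Z = a ` C \<union> b ` C"
    have Z: "finite Z" "Z \<subseteq> topspace X"
      using C(1) ab openin_subset[OF C(2)] by (auto simp: Z_def)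
    have G: "finite (C \<union> D n)" "\<forall>g\<in>C \<union> D n. openin X g"
      using C(1,2) D(1,2) by auto
    obtain C' where C': "finite C'" "\<And>p. p \<in> C' \<Longrightarrow> openin X p"
      "\<And>p. p \<in> C' \<Longrightarrow>
        \<exists>y\<in>p. (\<forall>q\<in>C'. y \<in> q \<longrightarrow> q = p) \<and> (\<forall>g\<in>C \<union> D n. y \<in> g \<longrightarrow> p \<subseteq> g)"
      "\<And>z. z \<in> topspace X \<Longrightarrow> \<exists>p\<in>C'. z \<in> p \<and> (\<forall>g\<in>C \<union> D n. z \<in> g \<longrightarrow> p \<subseteq> g)"
      "\<And>p x y. \<lbrakk>p \<in> C'; x \<in> p \<inter> Z; y \<in> p \<inter> Z\<rbrakk> \<Longrightarrow> x = y"
      by (fact ex_anchored_cover[OF t1 G Z])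
    have "good C'"
      unfolding good_def
    proof (intro conjI ballI subsetI)
      show "x \<in> \<Union>C'" if "x \<in> topspace X" for x using C'(4)[OF that] by blast
      show "\<exists>x\<in>p. \<forall>q\<in>C'. x \<in> q \<longrightarrow> q = p" if "p \<in> C'" for p using C'(3)[OF that] by blast
    qed (use C'(1,2) in auto)
    moreover have "next_cover n C C'"
      unfolding next_cover_def
    proof (intro conjI ballI)
      fix p assume p: "p \<in> C'"
      from C'(3)[OF p] obtain y
        where "y \<in> p" "(\<forall>q\<in>C'. y \<in> q \<longrightarrow> q = p) \<and> (\<forall>g\<in>C \<union> D n. y \<in> g \<longrightarrow> p \<subseteq> g)" ..
      then have y: "y \<in> p" "\<forall>g\<in>C \<union> D n. y \<in> g \<longrightarrow> p \<subseteq> g" by simp_all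
      then show "\<exists>y\<in>p. \<forall>g\<in>C. y \<in> g \<longrightarrow> p \<subseteq> g" by (intro bexI[of _ y]) auto
      have "y \<in> \<Union>(D n)" using y(1) D(3)[of n] openin_subset[OF C'(2)[OF p]] by blast
      then show "\<exists>d\<in>D n. p \<subseteq> d" using y by blast
    next
      fix q z assume "q \<in> C" "z \<in> q"
      moreover from this have "z \<in> topspace X" using openin_subset[OF C(2)] by blast
      ultimately show "\<exists>p\<in>C'. z \<in> p \<and> p \<subseteq> q" using C'(4)[of z] by blast
    next
      fix p assume "p \<in> C \<inter> C'"
      then show "\<exists>x. p = {x}" using C'(5)[of p "a p" "b p"] ab by (auto simp: Z_def)
    qed
    ultimately show ?thesis by blast
  qed
  obtain C where C: "\<And>n. good (C n)" and next_C: "\<And>n. next_cover n (C n) (C (Suc n))"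
    using dependent_nat_choice[of "\<lambda>_. good" next_cover] start step by metis
  have next_C: "\<forall>p\<in>C (Suc n). \<exists>y\<in>p. \<forall>g\<in>C n. y \<in> g \<longrightarrow> p \<subseteq> g"
    "\<forall>q\<in>C n. \<forall>z\<in>q. \<exists>p\<in>C (Suc n). z \<in> p \<and> p \<subseteq> q"
    "\<forall>p\<in>C n \<inter> C (Suc n). \<exists>x. p = {x}"
    "\<forall>p\<in>C (Suc n). \<exists>d\<in>D n. p \<subseteq> d" for n
    using next_C[of n] unfolding next_cover_def by simp_all
  have "refining_covers X C (\<lambda>p. p)"
  proof
    fix \<U> assume "\<And>U. U \<in> \<U> \<Longrightarrow> openin X U" "topspace X \<subseteq> \<Union>\<U>"
    then obtain n where n: "\<forall>d\<in>D n. \<exists>U\<in>\<U>. d \<subseteq> U" using universal[of \<U>] by blast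
    then show "\<exists>n. \<forall>i\<in>C n. \<exists>U\<in>\<U>. i \<subseteq> U" using next_C(4)[of n] by (meson subset_trans)
  next
    show "finite (C n)" for n using C[of n] unfolding good_def by blast
  next
    show "openin X i" if "i \<in> C n" for i n
      using C[of n] that unfolding good_def by blast
  next
    show "\<exists>i\<in>C n. x \<in> i" if "x \<in> topspace X" for x n
      using C[of n] that unfolding good_def by blast
  next
    show "\<exists>x\<in>i. \<forall>j\<in>C n. x \<in> j \<longrightarrow> j = i" if "i \<in> C n" for i n
      using C[of n] that unfolding good_def by blast
  next
    show "\<exists>i\<in>C (Suc n). x \<in> i \<and> i \<subseteq> j" if "j \<in> C n" "x \<in> j" for j x n
      using next_C(2)[of n] that by blast
  next
    show "\<exists>y\<in>i. \<forall>j\<in>C n. y \<in> j \<longrightarrow> i \<subseteq> j" if "i \<in> C (Suc n)" for i n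
      using next_C(1)[of n] that by (rule bspec)
  next
    show "\<exists>x. i = {x}" if "i \<in> C n" "i \<in> C (Suc n)" for i n
      by (rule bspec[OF next_C(3) IntI[OF that]])
  qed (use t1 in auto)
  then show ?thesis by blast
qed

lemma refining_covers_reindex:
  assumes "refining_covers X C (\<lambda>p. p)" and "inj_on f (\<Union>n. C n)"
  shows "refining_covers X (\<lambda>n. f ` C n) (inv_into (\<Union>n. C n) f)"
proof -
  interpret C: refining_covers X C "\<lambda>p. p" by fact
  let ?u = "inv_into (\<Union>n. C n) f"
  have u: "?u (f p) = p" if "p \<in> C n" for p n
    using that by (intro inv_into_f_f[OF assms(2)]) auto
  show ?thesis
  proof
    show "t1_space X" by (rule C.t1)
    show "inj_on ?u (\<Union>n. f ` C n)"
      by (rule inj_on_inv_into) auto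
    show "finite (f ` C n)" for n
      using C.finite_level by simp
    show "openin X (?u i)" if "i \<in> f ` C n" for i n
      using that u C.open_set by force
    show "\<exists>i\<in>f ` C n. x \<in> ?u i" if "x \<in> topspace X" for x n
    proof -
      obtain p where "p \<in> C n" "x \<in> p" using C.covers[OF \<open>x \<in> topspace X\<close>] by blast
      then show ?thesis using u by auto
    qed
    show "\<exists>x\<in>?u i. \<forall>j\<in>f ` C n. x \<in> ?u j \<longrightarrow> j = i" if i: "i \<in> f ` C n" for i n
    proof -
      obtain p where p: "p \<in> C n" "i = f p" using i by blast
      obtain x where x: "x \<in> p" "\<And>q. \<lbrakk>q \<in> C n; x \<in> q\<rbrakk> \<Longrightarrow> q = p"
        using C.owns_point[OF p(1)] by blast
      have "j = i" if "j \<in> f ` C n" "x \<in> ?u j" for j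
      proof -
        obtain q where q: "q \<in> C n" "j = f q" using \<open>j \<in> f ` C n\<close> by blast
        then have "q = p" using x(2)[of q] u[OF q(1)] \<open>x \<in> ?u j\<close> by blast
        then show ?thesis using p q by blast
      qed
      then show ?thesis using x(1) u[OF p(1)] p(2) by blast
    qed
    show "\<exists>y\<in>?u i. \<forall>j\<in>f ` C n. y \<in> ?u j \<longrightarrow> ?u i \<subseteq> ?u j" if i: "i \<in> f ` C (Suc n)" for i n
    proof -
      obtain p where p: "p \<in> C (Suc n)" "i = f p" using i by blast
      obtain y where y: "y \<in> p" "\<And>q. \<lbrakk>q \<in> C n; y \<in> q\<rbrakk> \<Longrightarrow> p \<subseteq> q"
        using C.anchored[OF p(1)] by blast
      then show ?thesis using u p by (intro bexI[of _ y]) auto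
    qed
    show "\<exists>i\<in>f ` C (Suc n). x \<in> ?u i \<and> ?u i \<subseteq> ?u j" if j: "j \<in> f ` C n" "x \<in> ?u j" for j n x
    proof -
      obtain q where q: "q \<in> C n" "j = f q" using j by blast
      then have "x \<in> q" using j u by auto
      then show ?thesis using C.union_of_next[OF q(1)] q u by auto
    qed
    show "\<exists>x. ?u i = {x}" if i: "i \<in> f ` C n" "i \<in> f ` C (Suc n)" for i n
    proof -
      have "?u i \<in> C m" if "i \<in> f ` C m" for m using that u by auto
      then have "?u i \<in> C n" "?u i \<in> C (Suc n)" using i by blast+
      then show ?thesis by (rule C.persistent_singleton)
    qed
    show "\<exists>n. \<forall>i\<in>f ` C n. \<exists>U\<in>\<U>. ?u i \<subseteq> U"
      if \<U>: "\<And>U. U \<in> \<U> \<Longrightarrow> openin X U" "topspace X \<subseteq> \<Union>\<U>" for \<U>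
    proof -
      obtain n where "\<forall>p\<in>C n. \<exists>U\<in>\<U>. p \<subseteq> U" using C.eventually_fine[of \<U>] \<U> by blast
      then have "\<forall>i\<in>f ` C n. \<exists>U\<in>\<U>. ?u i \<subseteq> U" using u by auto
      then show ?thesis ..
    qed
  qed
qed

theorem corollary2p10:
  fixes X :: "'a topology"
  assumes "second_countable X" and "compact_space X" and "t1_space X"
  shows "\<exists>(P :: nat set) (r :: nat rel).
           omega_poset P r \<and> graded_poset P r \<and> predetermined_poset P r \<and> branching_poset P r \<and>
           X homeomorphic_space spectrum_topology P r"
proof -
  obtain C where C: "refining_covers X C (\<lambda>p :: 'a set. p)"
    using ex_refining_sequence[OF assms] by blast
  have "countable (\<Union>n. C n)"
    using refining_covers.finite_level[OF C] by (auto intro: countable_finite)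
  then obtain f :: "'a set \<Rightarrow> nat" where "inj_on f (\<Union>n. C n)"
    by (auto simp: countable_def)
  then interpret refining_covers X "\<lambda>n. f ` C n" "inv_into (\<Union>n. C n) f"
    by (rule refining_covers_reindex[OF C])
  show ?thesis
    using omega_poset_le graded_poset_le predetermined_poset_le branching_poset_le
      homeomorphic_space_spectrum by blast
qed

end
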